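(* There exists an absolute constant $c>0$ such that for every positive integer $n$ and every non-constant function $f\colon\{0,1\}^n\to\{0,1\}$, $$\mathbb{E}_{x}\left[\sqrt{s_f(x)}\right]\;\geq\; c\cdot \mathrm{var}(f)\sqrt{\log\left(1+\frac{1}{\sum_{i=1}^{n} I_i[f]^2}\right)}.$$
   Context: Here $x$ is uniformly distributed over $\{0,1\}^n$, $\log$ denotes the base-$2$ logarithm, and $\mathrm{var}(f)=\mathbb{E}_x[f(x)^2]-\mathbb{E}_x[f(x)]^2$ is the variance of $f(x)$. The sensitivity $s_f(x)$ of $f$ at $x$ is the number of coordinates $i\in[n]=\{1,\dots,n\}$ such that $f(x\oplus e_i)\neq f(x)$, where $x\oplus e_i$ is $x$ with its $i$th bit flipped. The influence of coordinate $i$ is $I_i[f]=\Pr_{x}[f(x)\neq f(x\oplus e_i)]$. *)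

theory Defs
  imports "HOL-Probability.Probability"
begin

text \<open>
  The dimension \<open>n\<close> is a natural number rather than a type, so that one constant can serve
  all dimensions. A bit is a \<open>bool\<close>; points of the cube are extensional functions on
  \<open>{1..n}\<close>, so that each point is represented exactly once.
\<close>

definition cube :: "nat \<Rightarrow> (nat \<Rightarrow> bool) set" where
  "cube n = {1..n} \<rightarrow>\<^sub>E UNIV"

definition flip :: "(nat \<Rightarrow> bool) \<Rightarrow> nat \<Rightarrow> (nat \<Rightarrow> bool)" where
  "flip x i = x(i := \<not> x i)"

lemma finite_cube: "finite (cube n)"
  by (simp add: cube_def finite_PiE)

lemma cube_nonempty: "cube n \<noteq> {}"
  by (simp add: cube_def PiE_eq_empty_iff)

lemma flip_in_cube: "x \<in> cube n \<Longrightarrow> i \<in> {1..n} \<Longrightarrow> flip x i \<in> cube n"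
  by (auto simp: cube_def flip_def PiE_def extensional_def)

text \<open>\<open>pmf_of_set\<close> is the uniform distribution because \<open>cube n\<close> is finite and nonempty.\<close>

definition unif :: "nat \<Rightarrow> (nat \<Rightarrow> bool) pmf" where
  "unif n = pmf_of_set (cube n)"

definition sensitivity :: "nat \<Rightarrow> ((nat \<Rightarrow> bool) \<Rightarrow> bool) \<Rightarrow> (nat \<Rightarrow> bool) \<Rightarrow> nat" where
  "sensitivity n f x = card {i \<in> {1..n}. f (flip x i) \<noteq> f x}"

definition influence :: "nat \<Rightarrow> ((nat \<Rightarrow> bool) \<Rightarrow> bool) \<Rightarrow> nat \<Rightarrow> real" where
  "influence n f i = measure_pmf.prob (unif n) {x. f x \<noteq> f (flip x i)}"

text \<open>\<open>of_bool\<close> reads the values of \<open>f\<close> as the real numbers 0 and 1.\<close>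

definition var :: "nat \<Rightarrow> ((nat \<Rightarrow> bool) \<Rightarrow> bool) \<Rightarrow> real" where
  "var n f = measure_pmf.expectation (unif n) (\<lambda>x. (of_bool (f x))\<^sup>2)
             - (measure_pmf.expectation (unif n) (\<lambda>x. of_bool (f x)))\<^sup>2"

end

(*
  The cube is identified with the subsets of A = {1..n}. For a point x write s_J(x) for the number of
  sensitive coordinates in J, let M be the sum of the squared influences, V the variance,
  E the mean of sqrt(s_A), and W the squared Fourier weight on given levels.

  High levels. A two-point inequality of Bobkov type gives by induction E >= 2 V for every Boolean
  function. Apply this to the restrictions of f to a random set J of free coordinates that
  contains each coordinate with probability 1/d. By Jensen the left side loses a factor
  sqrt(1/d), while a Fourier character of degree at least d survives with probability at
  least 1/2; so E >= sqrt(d) W[>= d].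

  Low levels. Bonami's inequality bounds the noisy energy of h by |h|_1 |h|_2. Applied to noisy
  derivatives of f, whose L1 norms are at most the influences and whose squared L2 norms have
  bounded sum, it gives W[1, d) <= 16^d sqrt(M) / 2 by Cauchy-Schwarz. Applied to f minus its
  mean it gives W[1, d) <= 4^d 2 V^(3/2). If d is at most a small multiple of log(1/M), then
  one of the two bounds is at most V / 2, whether V is small or not. Hence W[>= d] >= V / 2.
*)

theory Submission
  imports Defs
begin

subsection \<open>Biased means over the subsets of a finite set\<close>

text \<open>The expectation over a random subset of \<open>A\<close> that contains each element
  independently with probability \<open>p\<close>. The bias is a parameter because three values
  matter: \<open>1/2\<close> for a uniform point, \<open>1/4\<close> for noise,
  \<open>1 / real d\<close> for random restrictions.\<close>

definition biased_mean :: "real \<Rightarrow> 'a set \<Rightarrow> ('a set \<Rightarrow> real) \<Rightarrow> real" where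
  "biased_mean p A g = (\<Sum>y\<in>Pow A. p ^ card y * (1 - p) ^ card (A - y) * g y)"

abbreviation mean :: "'a set \<Rightarrow> ('a set \<Rightarrow> real) \<Rightarrow> real" where
  "mean \<equiv> biased_mean (1/2)"

lemma sum_Pow_insert:
  fixes h :: "'a set \<Rightarrow> real"
  assumes "finite A" "i \<notin> A"
  shows "(\<Sum>y\<in>Pow (insert i A). h y) = (\<Sum>y\<in>Pow A. h y) + (\<Sum>y\<in>Pow A. h (insert i y))"
proof -
  have "inj_on (insert i) (Pow A)"
    using assms(2) by (auto simp: inj_on_def)
  moreover have "Pow A \<inter> insert i ` Pow A = {}"
    using assms(2) by auto
  ultimately show ?thesis
    using assms by (simp add: Pow_insert sum.union_disjoint sum.reindex)
qed

text \<open>Conditioning on whether \<open>i\<close> is chosen. The inductions over \<open>A\<close>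
  rest on this recursion.\<close>

lemma biased_mean_insert:
  assumes "finite A" "i \<notin> A"
  shows "biased_mean p (insert i A) g
    = p * biased_mean p A (\<lambda>y. g (insert i y)) + (1 - p) * biased_mean p A g"
proof -
  define w where "w B y = p ^ card y * (1 - p) ^ card (B - y)" for B y :: "'a set"
  have w: "w (insert i A) (insert i y) = p * w A y" "w (insert i A) y = (1 - p) * w A y" if "y \<in> Pow A" for y
  proof -
    have "finite y" "i \<notin> y" "insert i A - insert i y = A - y" "insert i A - y = insert i (A - y)"
      using that assms finite_subset[of y A] by auto
    then show "w (insert i A) (insert i y) = p * w A y" "w (insert i A) y = (1 - p) * w A y"
      using assms by (simp_all add: w_def)
  qed
  show ?thesis
    unfolding biased_mean_def w_def[symmetric] sum_Pow_insert[OF assms] sum_distrib_left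
    by (simp only: w mult.assoc add.commute cong: sum.cong)
qed

lemma biased_mean_empty [simp]: "biased_mean p {} g = g {}"
  by (simp add: biased_mean_def)

lemma biased_mean_cong:
  "(\<And>y. y \<subseteq> A \<Longrightarrow> g y = h y) \<Longrightarrow> biased_mean p A g = biased_mean p A h"
  by (auto simp: biased_mean_def intro!: sum.cong)

lemma biased_mean_add:
  "biased_mean p A (\<lambda>y. g y + h y) = biased_mean p A g + biased_mean p A h"
  by (simp add: biased_mean_def sum.distrib algebra_simps)

lemma biased_mean_diff:
  "biased_mean p A (\<lambda>y. g y - h y) = biased_mean p A g - biased_mean p A h"
  by (simp add: biased_mean_def sum_subtractf algebra_simps)

lemma biased_mean_cmult: "biased_mean p A (\<lambda>y. c * g y) = c * biased_mean p A g"
  by (simp add: biased_mean_def sum_distrib_left mult_ac)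

lemma biased_mean_cmult_right: "biased_mean p A (\<lambda>y. g y * c) = biased_mean p A g * c"
  by (simp add: biased_mean_def sum_distrib_right mult.assoc)

lemma biased_mean_sum:
  "biased_mean p A (\<lambda>y. \<Sum>k\<in>K. g k y) = (\<Sum>k\<in>K. biased_mean p A (g k))"
  unfolding biased_mean_def sum_distrib_left by (rule sum.swap)

lemma biased_mean_commute:
  "biased_mean p A (\<lambda>x. biased_mean q B (\<lambda>y. g x y))
    = biased_mean q B (\<lambda>y. biased_mean p A (\<lambda>x. g x y))"
  unfolding biased_mean_def sum_distrib_left
  by (subst sum.swap) (simp add: mult.left_commute)

lemma biased_mean_const [simp]: "finite A \<Longrightarrow> biased_mean p A (\<lambda>y. c) = c"
proof (induction A rule: finite_induct)
  case (insert i A)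
  then show ?case by (simp add: biased_mean_insert algebra_simps)
qed simp

lemma biased_mean_mono:
  assumes "0 \<le> p" "p \<le> 1" "\<And>y. y \<subseteq> A \<Longrightarrow> g y \<le> h y"
  shows "biased_mean p A g \<le> biased_mean p A h"
  unfolding biased_mean_def using assms by (intro sum_mono mult_left_mono) auto

lemma biased_mean_nonneg:
  assumes "0 \<le> p" "p \<le> 1" "\<And>y. y \<subseteq> A \<Longrightarrow> 0 \<le> g y"
  shows "0 \<le> biased_mean p A g"
  unfolding biased_mean_def using assms by (intro sum_nonneg mult_nonneg_nonneg) auto

lemma abs_biased_mean_le:
  assumes "0 \<le> p" "p \<le> 1"
  shows "\<bar>biased_mean p A g\<bar> \<le> biased_mean p A (\<lambda>y. \<bar>g y\<bar>)"
  unfolding biased_mean_def using assms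
  by (intro order_trans[OF sum_abs]) (simp add: abs_mult)

lemma biased_mean_Cauchy_Schwarz:
  assumes "0 \<le> p" "p \<le> 1"
  shows "(biased_mean p A (\<lambda>y. g y * h y))\<^sup>2
    \<le> biased_mean p A (\<lambda>y. (g y)\<^sup>2) * biased_mean p A (\<lambda>y. (h y)\<^sup>2)"
proof -
  define w where "w y = p ^ card y * (1 - p) ^ card (A - y)" for y
  have w: "0 \<le> w y" for y
    using assms by (simp add: w_def)
  have "biased_mean p A (\<lambda>y. k y * l y) = (\<Sum>y\<in>Pow A. (sqrt (w y) * k y) * (sqrt (w y) * l y))"
    for k l
    unfolding biased_mean_def w_def[symmetric]
  proof (rule sum.cong[OF refl])
    fix y
    have "(sqrt (w y) * k y) * (sqrt (w y) * l y) = (sqrt (w y) * sqrt (w y)) * (k y * l y)"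
      by (simp only: mult_ac)
    then show "w y * (k y * l y) = (sqrt (w y) * k y) * (sqrt (w y) * l y)"
      using w[of y] by simp
  qed
  then show ?thesis
    using Cauchy_Schwarz_ineq_sum[of "\<lambda>y. sqrt (w y) * g y" "\<lambda>y. sqrt (w y) * h y" "Pow A"]
    unfolding power2_eq_square by (simp only:)
qed

text \<open>The triangle inequality for a mean of plane vectors, with the pair of \<open>g\<close>
  and \<open>h\<close> read as a complex number. It passes a Euclidean norm through the mean in the
  induction for sensitivity.\<close>

lemma mean_hypot_le:
  "sqrt ((mean A g)\<^sup>2 + (mean A h)\<^sup>2) \<le> mean A (\<lambda>x. sqrt ((g x)\<^sup>2 + (h x)\<^sup>2))"
proof -
  define w where "w y = (1/2::real) ^ card y * (1 - 1/2) ^ card (A - y)" for y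
  have "sqrt ((mean A g)\<^sup>2 + (mean A h)\<^sup>2) = cmod (\<Sum>y\<in>Pow A. Complex (w y * g y) (w y * h y))"
    unfolding cmod_def Re_sum Im_sum by (simp add: biased_mean_def w_def)
  also have "\<dots> \<le> (\<Sum>y\<in>Pow A. cmod (Complex (w y * g y) (w y * h y)))"
    by (rule norm_sum)
  also have "\<dots> = mean A (\<lambda>x. sqrt ((g x)\<^sup>2 + (h x)\<^sup>2))"
    unfolding biased_mean_def w_def[symmetric]
  proof (rule sum.cong[OF refl])
    fix y assume "y \<in> Pow A"
    have "cmod (Complex (w y * g y) (w y * h y)) = sqrt ((w y)\<^sup>2 * ((g y)\<^sup>2 + (h y)\<^sup>2))"
      by (simp add: cmod_def power_mult_distrib algebra_simps)
    also have "\<dots> = w y * sqrt ((g y)\<^sup>2 + (h y)\<^sup>2)"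
      by (simp add: real_sqrt_mult w_def)
    finally show "cmod (Complex (w y * g y) (w y * h y)) = w y * sqrt ((g y)\<^sup>2 + (h y)\<^sup>2)" .
  qed
  finally show ?thesis .
qed

lemma mean_eq: "finite A \<Longrightarrow> mean A g = (\<Sum>x\<in>Pow A. g x) / 2 ^ card A"
proof (induction A arbitrary: g rule: finite_induct)
  case (insert i A)
  then show ?case
    by (simp add: biased_mean_insert sum_Pow_insert add_divide_distrib)
qed simp

lemma mean_translate:
  assumes "finite A" "y \<subseteq> A"
  shows "mean A (\<lambda>x. g (sym_diff x y)) = mean A g"
proof -
  have "(\<Sum>x\<in>Pow A. g (sym_diff x y)) = (\<Sum>x\<in>Pow A. g x)"
    by (rule sum.reindex_bij_witness[where i="\<lambda>x. sym_diff x y" and j="\<lambda>x. sym_diff x y"])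
      (use assms in \<open>auto intro!: arg_cong[where f=g]\<close>)
  then show ?thesis
    using assms by (simp add: mean_eq)
qed

lemma mean_Un_disjoint:
  assumes "finite J" "finite B" "B \<inter> J = {}"
  shows "mean (B \<union> J) g = mean B (\<lambda>z. mean J (\<lambda>y. g (z \<union> y)))"
  using assms
proof (induction J arbitrary: g rule: finite_induct)
  case (insert i J)
  then have *: "B \<inter> J = {}" "i \<notin> B \<union> J" "finite (B \<union> J)" by auto
  show ?case
    unfolding Un_insert_right biased_mean_insert[OF insert(1,2)] biased_mean_insert[OF *(3,2)]
      biased_mean_add biased_mean_cmult
    using insert * by simp
qed simp

subsection \<open>Walsh expansion\<close>

text \<open>These are the characters of the group of subsets under symmetric difference. The formula
  is symmetric in \<open>S\<close> and \<open>x\<close>, so identities in one argument transfer to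
  the other.\<close>

definition walsh :: "'a set \<Rightarrow> 'a set \<Rightarrow> real" where
  "walsh S x = (- 1) ^ card (S \<inter> x)"

definition coef :: "'a set \<Rightarrow> ('a set \<Rightarrow> real) \<Rightarrow> 'a set \<Rightarrow> real" where
  "coef A g S = mean A (\<lambda>x. g x * walsh S x)"

lemma minus_one_power_card_sym_diff:
  assumes "finite X" "finite Y"
  shows "(- 1) ^ card (sym_diff X Y) = ((- 1) ^ card X * (- 1) ^ card Y :: real)"
proof -
  have "card (sym_diff X Y) = card (X - Y) + card (Y - X)"
    using assms by (intro card_Un_disjoint) auto
  moreover have "card X = card (X - Y) + card (X \<inter> Y)" "card Y = card (Y - X) + card (X \<inter> Y)"
    using assms by (simp_all add: card_Diff_subset_Int Int_commute card_mono)
  ultimately have "card X + card Y = card (sym_diff X Y) + 2 * card (X \<inter> Y)"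
    by simp
  then show ?thesis
    by (simp flip: power_add) (simp add: power_add power_mult)
qed

lemma walsh_commute: "walsh S x = walsh x S"
  by (simp add: walsh_def Int_commute)

lemma walsh_sym_diff:
  assumes "finite x" "finite y"
  shows "walsh S (sym_diff x y) = walsh S x * walsh S y"
proof -
  have "S \<inter> sym_diff x y = sym_diff (S \<inter> x) (S \<inter> y)" by auto
  then show ?thesis
    using minus_one_power_card_sym_diff[of "S \<inter> x" "S \<inter> y"] assms by (simp add: walsh_def)
qed

lemma walsh_empty [simp]: "walsh {} x = 1" "walsh S {} = 1"
  by (simp_all add: walsh_def)

lemma walsh_insert:
  assumes "finite A" "y \<subseteq> A" "i \<notin> A"
  shows "walsh S (insert i y) = (if i \<in> S then - walsh S y else walsh S y)"
proof -
  have "finite y" "i \<notin> y" using assms finite_subset by auto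
  then show ?thesis by (simp add: walsh_def)
qed

text \<open>The coordinates are independent, and each one in \<open>S\<close> contributes
  \<open>(1 - p) - p\<close>. Bias \<open>1/2\<close> yields orthogonality, bias \<open>1/4\<close>
  the damping by noise.\<close>

lemma biased_mean_walsh:
  "finite A \<Longrightarrow> biased_mean p A (walsh S) = (1 - 2 * p) ^ card (S \<inter> A)"
proof (induction A rule: finite_induct)
  case (insert i A)
  have *: "biased_mean p A (\<lambda>y. walsh S (insert i y))
      = biased_mean p A (\<lambda>y. (if i \<in> S then - 1 else 1) * walsh S y)"
    using insert by (intro biased_mean_cong) (auto simp: walsh_insert)
  show ?case
    using insert unfolding biased_mean_insert[OF insert(1,2)] * biased_mean_cmult
    by (simp add: algebra_simps)
qed simp

text \<open>With \<open>J\<close> the free coordinates of a random restriction, this is the chance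
  that all of \<open>S\<close> gets fixed.\<close>

lemma biased_mean_disjoint:
  "finite A \<Longrightarrow> biased_mean p A (\<lambda>J. of_bool (S \<inter> J = {})) = (1 - p) ^ card (S \<inter> A)"
proof (induction A rule: finite_induct)
  case (insert i A)
  have *: "biased_mean p A (\<lambda>J. of_bool (S \<inter> insert i J = {}))
      = biased_mean p A (\<lambda>J. of_bool (i \<notin> S) * of_bool (S \<inter> J = {}))"
    by (intro biased_mean_cong) auto
  show ?case
    using insert unfolding biased_mean_insert[OF insert(1,2)] * biased_mean_cmult
    by (simp add: algebra_simps)
qed simp

lemma biased_mean_card:
  "finite A \<Longrightarrow> biased_mean p A (\<lambda>J. real (card (T \<inter> J))) = p * card (T \<inter> A)"
proof (induction A rule: finite_induct)
  case (insert i A)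
  have *: "biased_mean p A (\<lambda>J. real (card (T \<inter> insert i J)))
      = biased_mean p A (\<lambda>J. of_bool (i \<in> T) + real (card (T \<inter> J)))"
    using insert by (intro biased_mean_cong) (auto simp: finite_subset card_insert_if)
  show ?case
    using insert unfolding biased_mean_insert[OF insert(1,2)] * biased_mean_add
    by (simp add: algebra_simps)
qed simp

lemma mean_walsh_mult:
  assumes "finite A" "S \<subseteq> A" "T \<subseteq> A"
  shows "mean A (\<lambda>x. walsh S x * walsh T x) = of_bool (S = T)"
proof -
  have "mean A (\<lambda>x. walsh S x * walsh T x) = mean A (walsh (sym_diff S T))"
    using assms by (intro biased_mean_cong) (metis finite_subset walsh_commute walsh_sym_diff)
  \<comment> \<open>The factor \<open>1 - 2 * p\<close> vanishes at \<open>p = 1/2\<close>, and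
    \<open>0 ^ 0 = 1\<close> singles out the empty symmetric difference.\<close>
  also have "\<dots> = 0 ^ card (sym_diff S T \<inter> A)"
    using assms by (simp add: biased_mean_walsh)
  also have "\<dots> = of_bool (S = T)"
  proof -
    have "finite (sym_diff S T \<inter> A)" "sym_diff S T \<inter> A = {} \<longleftrightarrow> S = T" using assms by auto
    then show ?thesis by (auto simp: power_0_left)
  qed
  finally show ?thesis .
qed

lemma walsh_expansion:
  assumes "finite A" "x \<subseteq> A"
  shows "(\<Sum>S\<in>Pow A. coef A g S * walsh S x) = g x"
proof -
  have "(\<Sum>S\<in>Pow A. coef A g S * walsh S x)
      = (\<Sum>S\<in>Pow A. (\<Sum>y\<in>Pow A. g y * (walsh S y * walsh S x)) / 2 ^ card A)"
    using assms by (simp add: coef_def mean_eq sum_distrib_right mult.assoc)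
  \<comment> \<open>Exchanging the roles of index and point turns the inner sum into an
    orthogonality relation in which \<open>S\<close> is the point.\<close>
  also have "\<dots> = (\<Sum>y\<in>Pow A. g y * ((\<Sum>S\<in>Pow A. walsh y S * walsh x S) / 2 ^ card A))"
    unfolding sum_divide_distrib sum_distrib_left
    by (subst sum.swap) (simp add: walsh_commute)
  also have "\<dots> = (\<Sum>y\<in>Pow A. g y * of_bool (y = x))"
    using assms by (intro sum.cong refl) (simp add: mean_walsh_mult flip: mean_eq)
  also have "\<dots> = g x"
    using assms by (simp add: of_bool_def if_distrib[of "\<lambda>t. _ * t"] cong: if_cong)
  finally show ?thesis .
qed

lemma mean_mult_walsh_sum:
  "mean A (\<lambda>x. g x * (\<Sum>S\<in>Pow A. c S * walsh S x)) = (\<Sum>S\<in>Pow A. c S * coef A g S)"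
proof -
  have "mean A (\<lambda>x. g x * (\<Sum>S\<in>Pow A. c S * walsh S x))
      = mean A (\<lambda>x. \<Sum>S\<in>Pow A. c S * (g x * walsh S x))"
    by (simp add: sum_distrib_left mult_ac)
  then show ?thesis
    by (simp add: biased_mean_sum biased_mean_cmult coef_def)
qed

lemma parseval:
  assumes "finite A"
  shows "mean A (\<lambda>x. (g x)\<^sup>2) = (\<Sum>S\<in>Pow A. (coef A g S)\<^sup>2)"
proof -
  have "mean A (\<lambda>x. (g x)\<^sup>2) = mean A (\<lambda>x. g x * (\<Sum>S\<in>Pow A. coef A g S * walsh S x))"
    using assms by (intro biased_mean_cong) (simp add: walsh_expansion power2_eq_square)
  then show ?thesis
    by (simp add: mean_mult_walsh_sum power2_eq_square)
qed

subsection \<open>Hypercontractivity\<close>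

text \<open>Hypercontractivity for the exponents 2 and 4, by induction on the dimension. Along
  coordinate \<open>i\<close> the polynomial is \<open>a + b / 2\<close> or
  \<open>a - b / 2\<close>; odd powers of \<open>b\<close> cancel on average, and the cross term has
  coefficient 6/4, below the 2 in the expansion of \<open>(X + Y)\<^sup>2\<close>.\<close>

lemma bonami:
  fixes c :: "'a set \<Rightarrow> real"
  assumes "finite A"
  shows "mean A (\<lambda>x. (\<Sum>S\<in>Pow A. (1/2) ^ card S * c S * walsh S x) ^ 4) \<le> (\<Sum>S\<in>Pow A. (c S)\<^sup>2)\<^sup>2"
  using assms
proof (induction A arbitrary: c rule: finite_induct)
  case empty
  show ?case by simp
next
  case (insert i A)
  define a where "a x = (\<Sum>S\<in>Pow A. (1/2) ^ card S * c S * walsh S x)" for x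
  define b where "b x = (\<Sum>S\<in>Pow A. (1/2) ^ card S * c (insert i S) * walsh S x)" for x
  define X where "X = (\<Sum>S\<in>Pow A. (c S)\<^sup>2)"
  define Y where "Y = (\<Sum>S\<in>Pow A. (c (insert i S))\<^sup>2)"
  define p where "p x = (\<Sum>S\<in>Pow (insert i A). (1/2) ^ card S * c S * walsh S x)" for x
  have XY: "0 \<le> X" "0 \<le> Y"
    by (auto simp: X_def Y_def intro: sum_nonneg)
  have card: "card (insert i S) = Suc (card S)" if "S \<subseteq> A" for S
    using that insert(1,2) finite_subset[of S A] by (auto simp: card_insert_if)
  have w: "walsh (insert i S) x = walsh S x" "walsh S (insert i x) = walsh S x"
    "walsh (insert i S) (insert i x) = - walsh S x" if "x \<subseteq> A" "S \<subseteq> A" for x S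
  proof -
    have "i \<notin> x" "i \<notin> S" using that insert(2) by auto
    then show "walsh (insert i S) x = walsh S x" "walsh S (insert i x) = walsh S x"
      by (simp_all add: walsh_def)
    then show "walsh (insert i S) (insert i x) = - walsh S x"
      using walsh_insert[OF insert(1) that(1) insert(2)] by simp
  qed
  have p0: "p x = a x + b x / 2" and p1: "p (insert i x) = a x - b x / 2" if x: "x \<subseteq> A" for x
  proof -
    have "p x = a x + (\<Sum>S\<in>Pow A. (1/2) * ((1/2) ^ card S * c (insert i S) * walsh S x))"
      unfolding p_def a_def sum_Pow_insert[OF insert(1,2)]
      by (intro arg_cong2[of _ _ _ _ "(+)"] sum.cong refl) (use x in \<open>simp add: card w\<close>)
    then show "p x = a x + b x / 2"
      by (simp only: b_def flip: sum_distrib_left)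
    have "p (insert i x) = a x + (\<Sum>S\<in>Pow A. (- 1/2) * ((1/2) ^ card S * c (insert i S) * walsh S x))"
      unfolding p_def a_def sum_Pow_insert[OF insert(1,2)]
      by (intro arg_cong2[of _ _ _ _ "(+)"] sum.cong refl) (use x in \<open>simp_all add: card w\<close>)
    then show "p (insert i x) = a x - b x / 2"
      by (simp only: b_def flip: sum_distrib_left)
  qed
  have "mean (insert i A) (\<lambda>x. p x ^ 4)
      = (mean A (\<lambda>x. (a x - b x / 2) ^ 4) + mean A (\<lambda>x. (a x + b x / 2) ^ 4)) / 2"
    using insert(1,2)
    by (simp add: biased_mean_insert p0 p1 cong: biased_mean_cong)
  also have "\<dots> = mean A (\<lambda>x. ((a x - b x / 2) ^ 4 + (a x + b x / 2) ^ 4) * (1/2))"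
    by (simp only: biased_mean_add biased_mean_cmult_right)
  also have "(\<lambda>x. ((a x - b x / 2) ^ 4 + (a x + b x / 2) ^ 4) * (1/2))
      = (\<lambda>x. a x ^ 4 + (3/2) * ((a x)\<^sup>2 * (b x)\<^sup>2) + (1/16) * b x ^ 4)"
  proof
    fix x
    have "(u - v) ^ 4 + (u + v) ^ 4 = 2 * u ^ 4 + 12 * (u\<^sup>2 * v\<^sup>2) + 2 * v ^ 4" for u v :: real
      by algebra
    from this[of "a x" "b x / 2"]
    show "((a x - b x / 2) ^ 4 + (a x + b x / 2) ^ 4) * (1/2)
        = a x ^ 4 + (3/2) * ((a x)\<^sup>2 * (b x)\<^sup>2) + (1/16) * b x ^ 4"
      by (simp add: power_divide)
  qed
  also have "mean A \<dots> = mean A (\<lambda>x. a x ^ 4) + (3/2) * mean A (\<lambda>x. (a x)\<^sup>2 * (b x)\<^sup>2)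
      + (1/16) * mean A (\<lambda>x. b x ^ 4)"
    by (simp only: biased_mean_add biased_mean_cmult)
  finally have eq: "mean (insert i A) (\<lambda>x. p x ^ 4) = mean A (\<lambda>x. a x ^ 4)
      + (3/2) * mean A (\<lambda>x. (a x)\<^sup>2 * (b x)\<^sup>2) + (1/16) * mean A (\<lambda>x. b x ^ 4)" .
  have a4: "mean A (\<lambda>x. a x ^ 4) \<le> X\<^sup>2"
    unfolding a_def X_def by (rule insert.IH)
  have b4: "mean A (\<lambda>x. b x ^ 4) \<le> Y\<^sup>2"
    unfolding b_def Y_def by (rule insert.IH)
  \<comment> \<open>Cauchy-Schwarz reduces the cross term to the two fourth moments, which the
    induction hypothesis covers.\<close>
  have "(mean A (\<lambda>x. (a x)\<^sup>2 * (b x)\<^sup>2))\<^sup>2 \<le> mean A (\<lambda>x. a x ^ 4) * mean A (\<lambda>x. b x ^ 4)"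
    using biased_mean_Cauchy_Schwarz[of "1/2" A "\<lambda>x. (a x)\<^sup>2" "\<lambda>x. (b x)\<^sup>2"] by simp
  also have "\<dots> \<le> X\<^sup>2 * Y\<^sup>2"
    using a4 b4 by (intro mult_mono biased_mean_nonneg) auto
  also have "\<dots> = (X * Y)\<^sup>2"
    by (simp add: power_mult_distrib)
  finally have "mean A (\<lambda>x. (a x)\<^sup>2 * (b x)\<^sup>2) \<le> X * Y"
    by (rule power2_le_imp_le) (simp add: XY)
  moreover have "0 \<le> X * Y" "0 \<le> Y\<^sup>2"
    using XY by simp_all
  ultimately have "mean (insert i A) (\<lambda>x. p x ^ 4) \<le> X\<^sup>2 + 2 * (X * Y) + Y\<^sup>2"
    unfolding eq using a4 b4 by linarith
  also have "\<dots> = (X + Y)\<^sup>2"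
    by (simp add: power2_sum)
  also have "X + Y = (\<Sum>S\<in>Pow (insert i A). (c S)\<^sup>2)"
    by (simp only: X_def Y_def sum_Pow_insert[OF insert(1,2)])
  finally show ?case
    unfolding p_def .
qed

text \<open>Duality: the left side \<open>Q\<close> is the correlation of \<open>h\<close> with its
  doubly damped expansion \<open>p\<close>. Two uses of Cauchy-Schwarz bound
  \<open>Q\<^sup>2\<close> by the L1 norm of \<open>h\<close>, its L2 norm and the squared L4 norm
  of \<open>p\<close>; the last is at most \<open>Q\<close> by \<open>bonami\<close>, and one
  \<open>Q\<close> cancels.\<close>

lemma noisy_energy_le:
  assumes "finite A"
  shows "(\<Sum>S\<in>Pow A. (1/4) ^ card S * (coef A h S)\<^sup>2)
    \<le> mean A (\<lambda>x. \<bar>h x\<bar>) * sqrt (mean A (\<lambda>x. (h x)\<^sup>2))"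
proof -
  define c where "c S = (1/2) ^ card S * coef A h S" for S
  define p where "p x = (\<Sum>S\<in>Pow A. (1/2) ^ card S * c S * walsh S x)" for x
  define Q where "Q = (\<Sum>S\<in>Pow A. (1/4) ^ card S * (coef A h S)\<^sup>2)"
  have half: "(1/2::real) ^ k * (1/2) ^ k = (1/4) ^ k" for k
    by (simp flip: power_mult_distrib)
  have Q0: "0 \<le> Q"
    by (auto simp: Q_def intro!: sum_nonneg)
  have Q2: "Q = (\<Sum>S\<in>Pow A. (c S)\<^sup>2)"
    unfolding Q_def c_def half[symmetric] by (simp add: power2_eq_square mult_ac)
  have "mean A (\<lambda>x. h x * p x) = (\<Sum>S\<in>Pow A. (1/2) ^ card S * c S * coef A h S)"
    unfolding p_def by (rule mean_mult_walsh_sum)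
  also have "\<dots> = Q"
    unfolding Q_def c_def half[symmetric] by (simp add: power2_eq_square mult_ac)
  finally have hp: "mean A (\<lambda>x. h x * p x) = Q" .
  have p4: "mean A (\<lambda>x. p x ^ 4) \<le> Q\<^sup>2"
    unfolding p_def Q2 by (rule bonami[OF assms])
  define B where "B = mean A (\<lambda>x. \<bar>h x\<bar> * (p x)\<^sup>2)"
  have "B\<^sup>2 \<le> mean A (\<lambda>x. (h x)\<^sup>2) * mean A (\<lambda>x. p x ^ 4)"
    using biased_mean_Cauchy_Schwarz[of "1/2" A "\<lambda>x. \<bar>h x\<bar>" "\<lambda>x. (p x)\<^sup>2"] by (simp add: B_def)
  also have "\<dots> \<le> mean A (\<lambda>x. (h x)\<^sup>2) * Q\<^sup>2"
    by (intro mult_left_mono p4 biased_mean_nonneg) auto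
  finally have B: "B \<le> sqrt (mean A (\<lambda>x. (h x)\<^sup>2)) * Q"
    using Q0 real_le_rsqrt by (fastforce simp: real_sqrt_mult)
  \<comment> \<open>Writing \<open>h\<close> as a product of \<open>sqrt \<bar>h x\<bar>\<close> and
    its signed copy makes Cauchy-Schwarz produce the L1 norm.\<close>
  have "Q\<^sup>2 = (mean A (\<lambda>x. sqrt \<bar>h x\<bar> * (sgn (h x) * sqrt \<bar>h x\<bar> * p x)))\<^sup>2"
    unfolding hp[symmetric]
    by (intro arg_cong[of _ _ "\<lambda>t. t\<^sup>2"] biased_mean_cong) (simp add: sgn_if mult_ac flip: mult.assoc)
  also have "\<dots> \<le> mean A (\<lambda>x. (sqrt \<bar>h x\<bar>)\<^sup>2) * mean A (\<lambda>x. (sgn (h x) * sqrt \<bar>h x\<bar> * p x)\<^sup>2)"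
    by (rule biased_mean_Cauchy_Schwarz) auto
  also have "mean A (\<lambda>x. (sgn (h x) * sqrt \<bar>h x\<bar> * p x)\<^sup>2) = B"
    unfolding B_def by (intro biased_mean_cong) (simp add: power_mult_distrib sgn_if)
  also have "mean A (\<lambda>x. (sqrt \<bar>h x\<bar>)\<^sup>2) * B \<le> mean A (\<lambda>x. \<bar>h x\<bar>) * (sqrt (mean A (\<lambda>x. (h x)\<^sup>2)) * Q)"
    using B by (auto intro!: mult_left_mono biased_mean_nonneg)
  finally have "Q * Q \<le> (mean A (\<lambda>x. \<bar>h x\<bar>) * sqrt (mean A (\<lambda>x. (h x)\<^sup>2))) * Q"
    by (simp add: power2_eq_square mult_ac)
  moreover have "0 \<le> mean A (\<lambda>x. \<bar>h x\<bar>) * sqrt (mean A (\<lambda>x. (h x)\<^sup>2))"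
    by (intro mult_nonneg_nonneg biased_mean_nonneg real_sqrt_ge_zero) auto
  ultimately show ?thesis
    using Q0 unfolding Q_def[symmetric] by (cases "Q = 0") (auto simp: mult_le_cancel_right)
qed

subsection \<open>Sensitivity and variance\<close>

text \<open>The directions \<open>J\<close> are separate from the domain of \<open>f\<close> so that
  the same notion applies to restrictions, where only the coordinates in \<open>J\<close> are
  free.\<close>

definition sens :: "'a set \<Rightarrow> ('a set \<Rightarrow> bool) \<Rightarrow> 'a set \<Rightarrow> nat" where
  "sens J f x = card {i\<in>J. f (sym_diff x {i}) \<noteq> f x}"

lemma sens_insert:
  assumes "finite J" "i \<notin> J"
  shows "sens (insert i J) f x = sens J f x + of_bool (f (sym_diff x {i}) \<noteq> f x)"
proof -
  have "{j \<in> insert i J. f (sym_diff x {j}) \<noteq> f x} = (if f (sym_diff x {i}) \<noteq> f x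
      then insert i {j\<in>J. f (sym_diff x {j}) \<noteq> f x} else {j\<in>J. f (sym_diff x {j}) \<noteq> f x})"
    by auto
  then show ?thesis
    using assms by (simp add: sens_def)
qed

lemma sens_Un:
  assumes "z \<inter> J = {}"
  shows "sens J f (z \<union> y) = sens J (\<lambda>y. f (z \<union> y)) y"
proof -
  have "sym_diff (z \<union> y) {i} = z \<union> sym_diff y {i}" if "i \<in> J" for i
    using assms that by auto
  then show ?thesis
    unfolding sens_def by (intro arg_cong[of _ _ card] Collect_cong) auto
qed

text \<open>
  Bobkov's two-point inequality with \<open>2 * (t - t\<^sup>2)\<close> in place of the Gaussian isoperimetric profile.
  It is what makes the induction on the dimension close.
\<close>

lemma two_point_inequality:
  fixes a b :: real
  shows "4 * ((a + b) / 2 - ((a + b) / 2)\<^sup>2)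
    \<le> sqrt ((2 * (a - a\<^sup>2))\<^sup>2 + (a - b)\<^sup>2) + sqrt ((2 * (b - b\<^sup>2))\<^sup>2 + (a - b)\<^sup>2)"
proof -
  \<comment> \<open>\<open>w\<close> is the profile at the midpoint, and the profiles at
    \<open>a\<close> and \<open>b\<close> add up to \<open>2 * w - D\<^sup>2\<close>. After the
    triangle inequality only a comparison of squares is left, which \<open>w \<le> 1\<close>
    settles.\<close>
  define w where "w = 2 * ((a + b) / 2 - ((a + b) / 2)\<^sup>2)"
  define D where "D = a - b"
  have "w \<le> 1/2"
    using zero_le_power2[of "(a + b) / 2 - 1/2"] by (simp add: w_def power2_eq_square field_simps)
  then have "0 \<le> (1 - w) * D\<^sup>2"
    by (intro mult_nonneg_nonneg) auto
  moreover have "(2 * w - D\<^sup>2)\<^sup>2 + (2 * D)\<^sup>2 = (2 * w)\<^sup>2 + 4 * ((1 - w) * D\<^sup>2) + (D\<^sup>2)\<^sup>2"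
    by (simp add: power2_eq_square algebra_simps)
  ultimately have "(2 * w)\<^sup>2 \<le> (2 * w - D\<^sup>2)\<^sup>2 + (2 * D)\<^sup>2"
    by simp
  then have "2 * w \<le> sqrt ((2 * w - D\<^sup>2)\<^sup>2 + (2 * D)\<^sup>2)"
    by (rule real_le_rsqrt)
  also have "2 * w - D\<^sup>2 = 2 * (a - a\<^sup>2) + 2 * (b - b\<^sup>2)"
    by (simp add: w_def D_def power2_eq_square field_simps)
  also have "sqrt ((2 * (a - a\<^sup>2) + 2 * (b - b\<^sup>2))\<^sup>2 + (2 * D)\<^sup>2)
      \<le> sqrt ((2 * (a - a\<^sup>2))\<^sup>2 + D\<^sup>2) + sqrt ((2 * (b - b\<^sup>2))\<^sup>2 + D\<^sup>2)"
    using real_sqrt_sum_squares_triangle_ineq[of "2 * (a - a\<^sup>2)" "2 * (b - b\<^sup>2)" D D] by simp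
  finally show ?thesis
    by (simp add: w_def D_def)
qed

text \<open>Induction on the dimension. The two halves of the cube satisfy the bound by hypothesis,
  the direction \<open>i\<close> adds the indicator \<open>d\<close> to the sensitivity on both, and
  \<open>two_point_inequality\<close> recombines the halves.\<close>

lemma mean_sqrt_sens_ge:
  assumes "finite A"
  shows "2 * (mean A (\<lambda>x. of_bool (f x)) - (mean A (\<lambda>x. of_bool (f x)))\<^sup>2)
    \<le> mean A (\<lambda>x. sqrt (sens A f x))"
  using assms
proof (induction A arbitrary: f rule: finite_induct)
  case empty
  then show ?case by simp
next
  case (insert i A)
  define g where "g x = f (insert i x)" for x
  define d where "d x = (of_bool (g x \<noteq> f x) :: real)" for x
  define a where "a = mean A (\<lambda>x. of_bool (g x))"
  define b where "b = mean A (\<lambda>x. of_bool (f x))"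
  have flip: "sym_diff x {i} = insert i x" "sym_diff (insert i x) {i} = x" if "x \<subseteq> A" for x
    using that insert(2) by auto
  have s0: "real (sens (insert i A) f x) = sens A f x + d x" if "x \<subseteq> A" for x
    using insert(1,2) that by (simp add: sens_insert flip g_def d_def)
  have s1: "real (sens (insert i A) f (insert i x)) = sens A g x + d x" if "x \<subseteq> A" for x
  proof -
    have "sens A f (insert i x) = sens A g x"
      using insert(2) sens_Un[of "{i}" A f x] by (simp add: g_def[abs_def])
    then show ?thesis
      unfolding sens_insert[OF insert(1,2)] flip(2)[OF that] by (simp add: g_def d_def eq_commute)
  qed
  \<comment> \<open>The means of the two halves differ by at most the fraction of points that are
    sensitive in direction \<open>i\<close>.\<close>
  have "\<bar>a - b\<bar> = \<bar>mean A (\<lambda>x. of_bool (g x) - of_bool (f x))\<bar>"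
    by (simp add: a_def b_def biased_mean_diff)
  also have "\<dots> \<le> mean A (\<lambda>x. \<bar>of_bool (g x) - of_bool (f x)\<bar>)"
    by (rule abs_biased_mean_le) auto
  also have "\<dots> = mean A d"
    by (intro biased_mean_cong) (auto simp: d_def)
  finally have "\<bar>a - b\<bar> \<le> mean A d" .
  then have D: "(a - b)\<^sup>2 \<le> (mean A d)\<^sup>2"
    by (simp add: abs_le_square_iff[symmetric])
  have main: "sqrt ((2 * (m - m\<^sup>2))\<^sup>2 + (a - b)\<^sup>2) \<le> mean A (\<lambda>x. sqrt (sens A h x + d x))"
    if m: "m = mean A (\<lambda>x. of_bool (h x))" for h m
  proof -
    have "0 \<le> m" "m \<le> 1"
      using insert(1) biased_mean_mono[of "1/2" A "\<lambda>x. of_bool (h x)" "\<lambda>x. 1"]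
      by (auto simp: m intro!: biased_mean_nonneg)
    then have "0 \<le> m - m\<^sup>2"
      by (simp add: power2_eq_square mult_left_le)
    then have "(2 * (m - m\<^sup>2))\<^sup>2 \<le> (mean A (\<lambda>x. sqrt (sens A h x)))\<^sup>2"
      using insert.IH[of h] by (intro power_mono) (auto simp: m)
    then have "sqrt ((2 * (m - m\<^sup>2))\<^sup>2 + (a - b)\<^sup>2)
        \<le> sqrt ((mean A (\<lambda>x. sqrt (sens A h x)))\<^sup>2 + (mean A d)\<^sup>2)"
      using D by simp
    \<comment> \<open>Since \<open>d\<close> takes only the values 0 and 1, it equals its square, so
      the root of the new sensitivity is a Euclidean norm.\<close>
    also have "\<dots> \<le> mean A (\<lambda>x. sqrt ((sqrt (sens A h x))\<^sup>2 + (d x)\<^sup>2))"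
      by (rule mean_hypot_le)
    also have "\<dots> = mean A (\<lambda>x. sqrt (sens A h x + d x))"
      by (intro biased_mean_cong) (simp add: d_def)
    finally show ?thesis .
  qed
  have m: "mean (insert i A) (\<lambda>x. of_bool (f x)) = (a + b) / 2"
    using insert(1,2) by (simp add: biased_mean_insert a_def b_def g_def add_divide_distrib)
  have s: "mean (insert i A) (\<lambda>x. sqrt (sens (insert i A) f x))
      = (mean A (\<lambda>x. sqrt (sens A g x + d x)) + mean A (\<lambda>x. sqrt (sens A f x + d x))) / 2"
    using insert(1,2) by (simp add: biased_mean_insert s0 s1 add_divide_distrib cong: biased_mean_cong)
  show ?case
    unfolding m s using main[OF a_def] main[OF b_def] two_point_inequality[of a b] by argo
qed

lemma mean_of_bool_bounds:
  assumes "finite A"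
  shows "0 \<le> mean A (\<lambda>x. of_bool (f x))" "mean A (\<lambda>x. of_bool (f x)) \<le> 1"
  using assms biased_mean_mono[of "1/2" A "\<lambda>x. of_bool (f x)" "\<lambda>x. 1"]
  by (auto intro!: biased_mean_nonneg)

lemma of_bool_power2: "(of_bool b :: 'a :: semiring_1)\<^sup>2 = of_bool b"
  by (cases b) simp_all

lemma coef_empty: "coef A g {} = mean A g"
  by (simp add: coef_def)

text \<open>A 0/1 value equals its square, so the mean is the full Fourier weight by Parseval, and
  the squared mean is the term of the empty set.\<close>

lemma variance_eq_sum_coef:
  assumes "finite A"
  shows "mean A (\<lambda>x. of_bool (f x)) - (mean A (\<lambda>x. of_bool (f x)))\<^sup>2
    = (\<Sum>S\<in>Pow A - {{}}. (coef A (\<lambda>x. of_bool (f x)) S)\<^sup>2)"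
proof -
  have "mean A (\<lambda>x. of_bool (f x)) = mean A (\<lambda>x. (of_bool (f x))\<^sup>2)"
    by (intro biased_mean_cong) simp
  also have "\<dots> = (\<Sum>S\<in>Pow A. (coef A (\<lambda>x. of_bool (f x)) S)\<^sup>2)"
    by (rule parseval[OF assms])
  also have "\<dots> = (coef A (\<lambda>x. of_bool (f x)) {})\<^sup>2
      + (\<Sum>S\<in>Pow A - {{}}. (coef A (\<lambda>x. of_bool (f x)) S)\<^sup>2)"
    using assms by (intro sum.remove) auto
  finally show ?thesis
    by (simp add: coef_empty)
qed

text \<open>Fix the coordinates outside \<open>J\<close> to \<open>z\<close> and apply
  \<open>mean_sqrt_sens_ge\<close> to each restriction. Averaged over \<open>z\<close>, the
  variances of the restrictions add up to the Fourier weight on the sets meeting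
  \<open>J\<close>.\<close>

lemma mean_sqrt_sens_restricted_ge:
  assumes "finite A" "J \<subseteq> A"
  shows "2 * (\<Sum>S\<in>Pow A. of_bool (S \<inter> J \<noteq> {}) * (coef A (\<lambda>x. of_bool (f x)) S)\<^sup>2)
    \<le> mean A (\<lambda>x. sqrt (sens J f x))"
proof -
  define B where "B = A - J"
  define F where "F x = (of_bool (f x) :: real)" for x
  define G where "G z = mean J (\<lambda>y. F (z \<union> y))" for z
  have fin: "finite J" "finite B" "B \<inter> J = {}"
    using assms finite_subset by (auto simp: B_def)
  have A: "A = B \<union> J"
    using assms by (auto simp: B_def)
  have split: "mean A g = mean B (\<lambda>z. mean J (\<lambda>y. g (z \<union> y)))" for g
    unfolding A by (rule mean_Un_disjoint[OF fin])
  \<comment> \<open>A character supported in \<open>B\<close> is constant along \<open>J\<close>, so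
    averaging over \<open>J\<close> preserves its coefficient.\<close>
  have coefG: "coef B G S = coef A F S" if "S \<in> Pow B" for S
  proof -
    have "walsh S (z \<union> y) = walsh S z" if "y \<subseteq> J" for z y
    proof -
      have "S \<inter> (z \<union> y) = S \<inter> z"
        using \<open>S \<in> Pow B\<close> that fin(3) by auto
      then show ?thesis by (simp add: walsh_def)
    qed
    then have "coef A F S = mean B (\<lambda>z. mean J (\<lambda>y. F (z \<union> y) * walsh S z))"
      unfolding coef_def split by (intro biased_mean_cong) simp
    also have "\<dots> = coef B G S"
      by (simp only: coef_def G_def biased_mean_cmult_right)
    finally show ?thesis by simp
  qed
  have "(\<Sum>S\<in>Pow A. (coef A F S)\<^sup>2) = mean A (\<lambda>x. (F x)\<^sup>2)"
    by (rule parseval[symmetric, OF assms(1)])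
  also have "\<dots> = mean B G"
    unfolding split G_def by (intro biased_mean_cong) (simp add: F_def)
  finally have all: "(\<Sum>S\<in>Pow A. (coef A F S)\<^sup>2) = mean B G" .
  have "(\<Sum>S\<in>Pow A. of_bool (S \<inter> J = {}) * (coef A F S)\<^sup>2) = (\<Sum>S\<in>Pow B. (coef A F S)\<^sup>2)"
    using assms(1) by (intro sum.mono_neutral_cong_right) (auto simp: B_def)
  also have "\<dots> = (\<Sum>S\<in>Pow B. (coef B G S)\<^sup>2)"
    by (intro sum.cong refl) (simp only: coefG)
  also have "\<dots> = mean B (\<lambda>z. (G z)\<^sup>2)"
    by (rule parseval[symmetric, OF fin(2)])
  finally have disj: "(\<Sum>S\<in>Pow A. of_bool (S \<inter> J = {}) * (coef A F S)\<^sup>2) = mean B (\<lambda>z. (G z)\<^sup>2)" .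
  have "(\<Sum>S\<in>Pow A. of_bool (S \<inter> J \<noteq> {}) * (coef A F S)\<^sup>2)
      = (\<Sum>S\<in>Pow A. (coef A F S)\<^sup>2) - (\<Sum>S\<in>Pow A. of_bool (S \<inter> J = {}) * (coef A F S)\<^sup>2)"
    unfolding sum_subtractf[symmetric] by (intro sum.cong) auto
  also have "\<dots> = mean B (\<lambda>z. G z - (G z)\<^sup>2)"
    by (simp only: all disj biased_mean_diff)
  finally have "2 * (\<Sum>S\<in>Pow A. of_bool (S \<inter> J \<noteq> {}) * (coef A F S)\<^sup>2) = mean B (\<lambda>z. 2 * (G z - (G z)\<^sup>2))"
    by (simp only: biased_mean_cmult)
  also have "\<dots> \<le> mean B (\<lambda>z. mean J (\<lambda>y. sqrt (sens J f (z \<union> y))))"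
  proof (rule biased_mean_mono)
    fix z assume "z \<subseteq> B"
    then have "z \<inter> J = {}" using fin(3) by auto
    show "2 * (G z - (G z)\<^sup>2) \<le> mean J (\<lambda>y. sqrt (sens J f (z \<union> y)))"
      unfolding G_def F_def sens_Un[OF \<open>z \<inter> J = {}\<close>] by (rule mean_sqrt_sens_ge[OF fin(1)])
  qed auto
  also have "\<dots> = mean A (\<lambda>x. sqrt (sens J f x))"
    by (simp only: split)
  finally show ?thesis
    unfolding F_def .
qed

subsection \<open>High-degree weight by random restriction\<close>

lemma biased_mean_sqrt_le:
  assumes "finite A" "0 \<le> p" "p \<le> 1" "\<And>y. 0 \<le> g y"
  shows "biased_mean p A (\<lambda>y. sqrt (g y)) \<le> sqrt (biased_mean p A g)"
proof (rule real_le_rsqrt)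
  show "(biased_mean p A (\<lambda>y. sqrt (g y)))\<^sup>2 \<le> biased_mean p A g"
    using biased_mean_Cauchy_Schwarz[OF assms(2,3), of A "\<lambda>y. sqrt (g y)" "\<lambda>y. 1"] assms by simp
qed

text \<open>Follows from \<open>1 - t \<le> exp (- t)\<close> and
  \<open>exp 1 \<ge> 2\<close>.\<close>

lemma one_minus_inverse_power_le_half:
  assumes "1 \<le> d" "d \<le> k"
  shows "(1 - 1 / real d) ^ k \<le> 1 / 2"
proof -
  have d: "0 \<le> 1 - 1 / real d"
    using assms by simp
  have "(1 - 1 / real d) ^ k \<le> (1 - 1 / real d) ^ d"
    using assms d by (intro power_decreasing) auto
  also have "\<dots> \<le> exp (- 1 / real d) ^ d"
    using d exp_ge_add_one_self[of "- 1 / real d"] by (intro power_mono) auto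
  also have "\<dots> = exp (- 1)"
    using assms by (simp flip: exp_of_nat_mult)
  also have "\<dots> \<le> 1 / 2"
    using exp_ge_add_one_self[of "1 :: real"] by (simp add: exp_minus field_simps)
  finally show ?thesis .
qed

text \<open>Let \<open>J\<close> contain each coordinate with probability \<open>1 / real d\<close>.
  A set of size at least \<open>d\<close> meets \<open>J\<close> with probability at least 1/2,
  which the factor 2 of the restricted bound compensates, while the mean root sensitivity shrinks by
  \<open>sqrt p\<close>.\<close>

lemma high_degree_weight_le:
  fixes d :: nat
  assumes "finite A" "1 \<le> d"
  shows "sqrt d * (\<Sum>S\<in>{S\<in>Pow A. d \<le> card S}. (coef A (\<lambda>x. of_bool (f x)) S)\<^sup>2)
    \<le> mean A (\<lambda>x. sqrt (sens A f x))"
proof -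
  define c where "c S = (coef A (\<lambda>x. of_bool (f x)) S)\<^sup>2" for S
  define p where "p = 1 / real d"
  have p: "0 \<le> p" "p \<le> 1"
    using assms(2) by (auto simp: p_def)
  have "(\<Sum>S\<in>{S\<in>Pow A. d \<le> card S}. c S) \<le> (\<Sum>S\<in>{S\<in>Pow A. d \<le> card S}. 2 * ((1 - (1 - p) ^ card S) * c S))"
  proof (rule sum_mono)
    fix S assume "S \<in> {S\<in>Pow A. d \<le> card S}"
    then have "1 \<le> 2 * (1 - (1 - p) ^ card S)"
      using one_minus_inverse_power_le_half[of d "card S"] assms(2) by (simp add: p_def)
    then have "1 * c S \<le> 2 * (1 - (1 - p) ^ card S) * c S"
      by (rule mult_right_mono) (simp add: c_def)
    then show "c S \<le> 2 * ((1 - (1 - p) ^ card S) * c S)"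
      by (simp only: mult_1 mult.assoc)
  qed
  also have "\<dots> \<le> (\<Sum>S\<in>Pow A. 2 * ((1 - (1 - p) ^ card S) * c S))"
    using assms(1) p by (intro sum_mono2) (auto simp: c_def power_le_one)
  also have "\<dots> = (\<Sum>S\<in>Pow A. 2 * (biased_mean p A (\<lambda>J. of_bool (S \<inter> J \<noteq> {})) * c S))"
  proof (intro sum.cong refl)
    fix S assume S: "S \<in> Pow A"
    have "biased_mean p A (\<lambda>J. of_bool (S \<inter> J \<noteq> {})) = biased_mean p A (\<lambda>J. 1 - of_bool (S \<inter> J = {}))"
      by (intro biased_mean_cong) simp
    also have "\<dots> = 1 - (1 - p) ^ card S"
      using assms(1) S by (simp add: biased_mean_diff biased_mean_disjoint Int_absorb2)
    finally show "2 * ((1 - (1 - p) ^ card S) * c S)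
        = 2 * (biased_mean p A (\<lambda>J. of_bool (S \<inter> J \<noteq> {})) * c S)"
      by simp
  qed
  also have "\<dots> = biased_mean p A (\<lambda>J. 2 * (\<Sum>S\<in>Pow A. of_bool (S \<inter> J \<noteq> {}) * c S))"
    by (simp only: biased_mean_cmult biased_mean_sum biased_mean_cmult_right sum_distrib_left)
  also have "\<dots> \<le> biased_mean p A (\<lambda>J. mean A (\<lambda>x. sqrt (sens J f x)))"
    unfolding c_def by (intro biased_mean_mono p mean_sqrt_sens_restricted_ge assms(1))
  \<comment> \<open>With the mean over \<open>J\<close> innermost, Jensen applies at each fixed
    \<open>x\<close>, where the sensitive coordinates form a fixed set \<open>T\<close>.\<close>
  also have "\<dots> = mean A (\<lambda>x. biased_mean p A (\<lambda>J. sqrt (sens J f x)))"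
    by (rule biased_mean_commute)
  also have "\<dots> \<le> mean A (\<lambda>x. sqrt p * sqrt (sens A f x))"
  proof (rule biased_mean_mono)
    fix x
    define T where "T = {i\<in>A. f (sym_diff x {i}) \<noteq> f x}"
    have "biased_mean p A (\<lambda>J. sqrt (sens J f x)) = biased_mean p A (\<lambda>J. sqrt (card (T \<inter> J)))"
    proof (rule biased_mean_cong)
      fix J assume "J \<subseteq> A"
      then have "{i\<in>J. f (sym_diff x {i}) \<noteq> f x} = T \<inter> J"
        by (auto simp: T_def)
      then show "sqrt (sens J f x) = sqrt (card (T \<inter> J))"
        by (simp only: sens_def)
    qed
    also have "\<dots> \<le> sqrt (biased_mean p A (\<lambda>J. card (T \<inter> J)))"
      by (rule biased_mean_sqrt_le[OF assms(1) p]) simp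
    also have "\<dots> = sqrt (p * card (T \<inter> A))"
      by (simp only: biased_mean_card[OF assms(1)])
    also have "T \<inter> A = T"
      by (auto simp: T_def)
    also have "sqrt (p * card T) = sqrt p * sqrt (sens A f x)"
      by (simp add: real_sqrt_mult T_def sens_def)
    finally show "biased_mean p A (\<lambda>J. sqrt (sens J f x)) \<le> sqrt p * sqrt (sens A f x)" .
  qed auto
  also have "\<dots> = sqrt p * mean A (\<lambda>x. sqrt (sens A f x))"
    by (rule biased_mean_cmult)
  finally have "sqrt d * (\<Sum>S\<in>{S\<in>Pow A. d \<le> card S}. c S)
      \<le> sqrt d * (sqrt p * mean A (\<lambda>x. sqrt (sens A f x)))"
    by (rule mult_left_mono) simp
  also have "\<dots> = mean A (\<lambda>x. sqrt (sens A f x))"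
    using assms(2) by (simp add: p_def real_sqrt_divide)
  finally show ?thesis
    unfolding c_def .
qed

subsection \<open>Low-degree weight\<close>

lemma coef_translate:
  assumes "finite A" "y \<subseteq> A"
  shows "coef A (\<lambda>x. g (sym_diff x y)) S = walsh S y * coef A g S"
proof -
  have *: "sym_diff (sym_diff x y) y = x" for x
    by auto
  have "coef A (\<lambda>x. g (sym_diff x y)) S
      = mean A (\<lambda>x. (\<lambda>x. g x * walsh S (sym_diff x y)) (sym_diff x y))"
    unfolding coef_def * ..
  also have "\<dots> = mean A (\<lambda>x. g x * walsh S (sym_diff x y))"
    by (rule mean_translate[OF assms])
  also have "\<dots> = mean A (\<lambda>x. walsh S y * (g x * walsh S x))"
    using assms finite_subset by (intro biased_mean_cong) (subst walsh_sym_diff; auto)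
  also have "\<dots> = walsh S y * coef A g S"
    by (simp only: biased_mean_cmult coef_def)
  finally show ?thesis .
qed

text \<open>Flipping each bit with probability \<open>1/4\<close> is the noise operator of
  correlation 1/2: it damps level \<open>k\<close> by \<open>(1/2) ^ k\<close>.\<close>

definition noise :: "'a set \<Rightarrow> ('a set \<Rightarrow> real) \<Rightarrow> 'a set \<Rightarrow> real" where
  "noise A g x = biased_mean (1/4) A (\<lambda>y. g (sym_diff x y))"

lemma coef_noise:
  assumes "finite A" "S \<subseteq> A"
  shows "coef A (noise A g) S = (1/2) ^ card S * coef A g S"
proof -
  have "coef A (noise A g) S = mean A (\<lambda>x. biased_mean (1/4) A (\<lambda>y. g (sym_diff x y) * walsh S x))"
    by (simp only: coef_def noise_def biased_mean_cmult_right)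
  also have "\<dots> = biased_mean (1/4) A (\<lambda>y. coef A (\<lambda>x. g (sym_diff x y)) S)"
    unfolding coef_def by (rule biased_mean_commute)
  also have "\<dots> = biased_mean (1/4) A (\<lambda>y. walsh S y * coef A g S)"
    by (intro biased_mean_cong coef_translate assms)
  also have "\<dots> = biased_mean (1/4) A (walsh S) * coef A g S"
    by (rule biased_mean_cmult_right)
  finally show ?thesis
    using assms by (simp add: biased_mean_walsh Int_absorb2)
qed

text \<open>Noise is an average of translates, and every translate has the same L1 norm.\<close>

lemma mean_abs_noise_le:
  assumes "finite A"
  shows "mean A (\<lambda>x. \<bar>noise A g x\<bar>) \<le> mean A (\<lambda>x. \<bar>g x\<bar>)"
proof -
  have "mean A (\<lambda>x. \<bar>noise A g x\<bar>) \<le> mean A (\<lambda>x. biased_mean (1/4) A (\<lambda>y. \<bar>g (sym_diff x y)\<bar>))"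
    unfolding noise_def by (intro biased_mean_mono abs_biased_mean_le) auto
  also have "\<dots> = biased_mean (1/4) A (\<lambda>y. mean A (\<lambda>x. \<bar>g (sym_diff x y)\<bar>))"
    by (rule biased_mean_commute)
  also have "\<dots> = biased_mean (1/4) A (\<lambda>y. mean A (\<lambda>x. \<bar>g x\<bar>))"
    by (intro biased_mean_cong mean_translate[OF assms, of _ "\<lambda>x. \<bar>g x\<bar>"])
  finally show ?thesis
    using assms by simp
qed

section \<open>Influences and the energy of discrete derivatives\<close>

definition infl :: "'a set \<Rightarrow> ('a set \<Rightarrow> bool) \<Rightarrow> 'a \<Rightarrow> real" where
  "infl A f i = mean A (\<lambda>x. of_bool (f x \<noteq> f (sym_diff x {i})))"

text \<open>\<open>noisy_energy_le\<close> applied to the noisy derivative in direction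
  \<open>i\<close>. The two dampings by \<open>(1/4) ^ card S\<close> multiply to
  \<open>(1/16) ^ card S\<close> on the left; the one remaining under the root is what makes these
  energies summable over \<open>i\<close>.\<close>

lemma coordinate_energy_le:
  fixes f :: "'a set \<Rightarrow> bool"
  defines "F \<equiv> \<lambda>x. of_bool (f x)"
  assumes "finite A" "i \<in> A"
  shows "(\<Sum>S\<in>Pow A. of_bool (i \<in> S) * ((1/16) ^ card S * (coef A F S)\<^sup>2))
    \<le> infl A f i / 2 * sqrt (\<Sum>S\<in>Pow A. of_bool (i \<in> S) * ((1/4) ^ card S * (coef A F S)\<^sup>2))"
proof -
  \<comment> \<open>Flipping bit \<open>i\<close> negates exactly the characters that contain
    \<open>i\<close>, so half the difference keeps those coefficients and removes the
    others.\<close>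
  define D where "D x = (F x - F (sym_diff x {i})) * (1/2)" for x
  have D: "coef A D S = of_bool (i \<in> S) * coef A F S" for S
  proof -
    have "coef A D S = mean A (\<lambda>x. (F x * walsh S x - F (sym_diff x {i}) * walsh S x) * (1/2))"
      unfolding coef_def D_def by (intro biased_mean_cong) (simp add: left_diff_distrib)
    also have "\<dots> = (coef A F S - coef A (\<lambda>x. F (sym_diff x {i})) S) * (1/2)"
      by (simp only: coef_def biased_mean_diff biased_mean_cmult_right)
    also have "\<dots> = (coef A F S - walsh S {i} * coef A F S) * (1/2)"
      using assms by (subst coef_translate) auto
    also have "\<dots> = of_bool (i \<in> S) * coef A F S"
      by (simp add: walsh_def)
    finally show ?thesis .
  qed
  have h: "(coef A (noise A D) S)\<^sup>2 = of_bool (i \<in> S) * ((1/4) ^ card S * (coef A F S)\<^sup>2)"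
    if "S \<in> Pow A" for S
  proof -
    have "((1/2::real) ^ card S)\<^sup>2 = (1/4) ^ card S"
      by (simp add: power2_eq_square flip: power_mult_distrib)
    then show ?thesis
      using that assms(2) D by (simp add: coef_noise power_mult_distrib)
  qed
  have "(\<Sum>S\<in>Pow A. of_bool (i \<in> S) * ((1/16) ^ card S * (coef A F S)\<^sup>2))
      = (\<Sum>S\<in>Pow A. (1/4) ^ card S * (coef A (noise A D) S)\<^sup>2)"
  proof (intro sum.cong refl)
    fix S assume S: "S \<in> Pow A"
    have "(1/16::real) ^ card S = (1/4) ^ card S * (1/4) ^ card S"
      by (simp flip: power_mult_distrib)
    then show "of_bool (i \<in> S) * ((1/16) ^ card S * (coef A F S)\<^sup>2)
        = (1/4) ^ card S * (coef A (noise A D) S)\<^sup>2"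
      by (simp only: h[OF S] mult_ac)
  qed
  also have "\<dots> \<le> mean A (\<lambda>x. \<bar>noise A D x\<bar>) * sqrt (mean A (\<lambda>x. (noise A D x)\<^sup>2))"
    by (rule noisy_energy_le[OF assms(2)])
  also have "mean A (\<lambda>x. (noise A D x)\<^sup>2)
      = (\<Sum>S\<in>Pow A. of_bool (i \<in> S) * ((1/4) ^ card S * (coef A F S)\<^sup>2))"
    unfolding parseval[OF assms(2)] by (intro sum.cong refl h)
  also have "mean A (\<lambda>x. \<bar>noise A D x\<bar>) \<le> infl A f i / 2"
  proof -
    have "mean A (\<lambda>x. \<bar>noise A D x\<bar>) \<le> mean A (\<lambda>x. \<bar>D x\<bar>)"
      by (rule mean_abs_noise_le[OF assms(2)])
    also have "\<dots> = mean A (\<lambda>x. of_bool (f x \<noteq> f (sym_diff x {i})) * (1/2))"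
      by (intro biased_mean_cong) (simp add: D_def F_def)
    also have "\<dots> = infl A f i * (1/2)"
      unfolding infl_def by (rule biased_mean_cmult_right)
    finally show ?thesis by simp
  qed
  finally show ?thesis
    by (simp add: mult_right_mono sum_nonneg)
qed


text \<open>Summing over \<open>i\<close> counts each set \<open>card S\<close> times.
  Cauchy-Schwarz then separates the influences from the energies \<open>a i\<close>, whose sum is at
  most 1 because the damping absorbs the factor \<open>card S\<close>.\<close>

lemma low_degree_energy_le:
  fixes f :: "'a set \<Rightarrow> bool"
  defines "F \<equiv> \<lambda>x. of_bool (f x)"
  assumes "finite A"
  shows "(\<Sum>S\<in>Pow A. card S * ((1/16) ^ card S * (coef A F S)\<^sup>2))
    \<le> sqrt (\<Sum>i\<in>A. (infl A f i)\<^sup>2) / 2"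
proof -
  have double_count: "(\<Sum>i\<in>A. \<Sum>S\<in>Pow A. of_bool (i \<in> S) * g S) = (\<Sum>S\<in>Pow A. card S * g S)"
    for g :: "'a set \<Rightarrow> real"
  proof -
    have "(\<Sum>i\<in>A. of_bool (i \<in> S)) = real (card S)" if "S \<in> Pow A" for S
      using assms(2) that by (simp add: of_bool_def sum.If_cases Int_absorb1)
    then show ?thesis
      by (subst sum.swap) (simp only: cong: sum.cong flip: sum_distrib_right)
  qed
  define a where "a i = (\<Sum>S\<in>Pow A. of_bool (i \<in> S) * ((1/4) ^ card S * (coef A F S)\<^sup>2))" for i
  have a0: "0 \<le> a i" for i
    by (simp add: a_def sum_nonneg)
  have "(\<Sum>i\<in>A. a i) = (\<Sum>S\<in>Pow A. card S * ((1/4) ^ card S * (coef A F S)\<^sup>2))"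
    unfolding a_def by (rule double_count)
  also have "\<dots> \<le> (\<Sum>S\<in>Pow A. (coef A F S)\<^sup>2)"
  proof (rule sum_mono)
    fix S :: "'a set"
    have "card S < 2 ^ card S"
      by (rule less_exp)
    also have "\<dots> \<le> 4 ^ card S"
      by (rule power_mono) auto
    finally have "real (card S) * (1/4) ^ card S \<le> 1"
      by (simp add: power_one_over field_simps)
    then have "real (card S) * (1/4) ^ card S * (coef A F S)\<^sup>2 \<le> 1 * (coef A F S)\<^sup>2"
      by (rule mult_right_mono) simp
    then show "card S * ((1/4) ^ card S * (coef A F S)\<^sup>2) \<le> (coef A F S)\<^sup>2"
      by (simp add: mult.assoc)
  qed
  also have "\<dots> = mean A (\<lambda>x. (F x)\<^sup>2)"
    by (rule parseval[symmetric, OF assms(2)])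
  also have "\<dots> \<le> 1"
    using mean_of_bool_bounds(2)[OF assms(2), of f] by (simp only: F_def of_bool_power2)
  finally have a1: "(\<Sum>i\<in>A. a i) \<le> 1" .
  have "(\<Sum>S\<in>Pow A. card S * ((1/16) ^ card S * (coef A F S)\<^sup>2))
      = (\<Sum>i\<in>A. \<Sum>S\<in>Pow A. of_bool (i \<in> S) * ((1/16) ^ card S * (coef A F S)\<^sup>2))"
    by (rule double_count[symmetric])
  also have "\<dots> \<le> (\<Sum>i\<in>A. infl A f i / 2 * sqrt (a i))"
    unfolding a_def F_def by (intro sum_mono coordinate_energy_le assms)
  also have "\<dots> = (\<Sum>i\<in>A. infl A f i * sqrt (a i)) / 2"
    by (simp add: sum_divide_distrib)
  also have "(\<Sum>i\<in>A. infl A f i * sqrt (a i)) \<le> sqrt (\<Sum>i\<in>A. (infl A f i)\<^sup>2)"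
  proof (rule real_le_rsqrt)
    have "(\<Sum>i\<in>A. infl A f i * sqrt (a i))\<^sup>2 \<le> (\<Sum>i\<in>A. (infl A f i)\<^sup>2) * (\<Sum>i\<in>A. (sqrt (a i))\<^sup>2)"
      by (rule Cauchy_Schwarz_ineq_sum)
    also have "\<dots> \<le> (\<Sum>i\<in>A. (infl A f i)\<^sup>2)"
      using a0 a1 by (simp add: mult_left_le sum_nonneg)
    finally show "(\<Sum>i\<in>A. infl A f i * sqrt (a i))\<^sup>2 \<le> (\<Sum>i\<in>A. (infl A f i)\<^sup>2)" .
  qed
  finally show ?thesis
    by simp
qed

text \<open>\<open>noisy_energy_le\<close> applied to the centred function \<open>h\<close>, whose
  L1 norm is \<open>2 * V\<close> and whose squared L2 norm is \<open>V\<close>.\<close>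

lemma variance_energy_le:
  fixes f :: "'a set \<Rightarrow> bool"
  defines "F \<equiv> \<lambda>x. of_bool (f x)"
  assumes "finite A"
  defines "V \<equiv> mean A F - (mean A F)\<^sup>2"
  shows "(\<Sum>S\<in>Pow A - {{}}. (1/4) ^ card S * (coef A F S)\<^sup>2) \<le> 2 * V * sqrt V"
proof -
  define m where "m = mean A F"
  define h where "h x = F x - m" for x
  have m: "0 \<le> m" "m \<le> 1"
    using mean_of_bool_bounds[OF assms(2), of f] by (simp_all add: m_def F_def)
  have coef_h: "coef A h S = coef A F S" if "S \<in> Pow A - {{}}" for S
  proof -
    have "coef A h S = mean A (\<lambda>x. F x * walsh S x - m * walsh S x)"
      by (simp only: coef_def h_def left_diff_distrib)
    also have "\<dots> = coef A F S - m * mean A (walsh S)"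
      by (simp only: coef_def biased_mean_diff biased_mean_cmult)
    also have "mean A (walsh S) = 0"
      using that assms(2) finite_subset[of S A]
      by (simp add: biased_mean_walsh Int_absorb2 power_0_left card_gt_0_iff)
    finally show ?thesis by simp
  qed
  \<comment> \<open>On the values 0 and 1 of \<open>F\<close> the absolute deviation agrees with an
    affine function of \<open>F\<close>, so its mean depends on \<open>m\<close> alone.\<close>
  have "mean A (\<lambda>x. \<bar>h x\<bar>) = mean A (\<lambda>x. F x * (1 - 2 * m) + m)"
    using m by (intro biased_mean_cong) (simp add: h_def F_def)
  also have "\<dots> = m * (1 - 2 * m) + m"
    using assms(2) by (simp only: biased_mean_add biased_mean_cmult_right biased_mean_const m_def)
  also have "\<dots> = 2 * V"
    by (simp add: V_def m_def power2_eq_square algebra_simps)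
  finally have abs: "mean A (\<lambda>x. \<bar>h x\<bar>) = 2 * V" .
  have "mean A (\<lambda>x. (h x)\<^sup>2) = mean A (\<lambda>x. F x * (1 - 2 * m) + m\<^sup>2)"
    by (intro biased_mean_cong) (simp add: h_def F_def power2_eq_square algebra_simps)
  also have "\<dots> = m * (1 - 2 * m) + m\<^sup>2"
    using assms(2) by (simp only: biased_mean_add biased_mean_cmult_right biased_mean_const m_def)
  also have "\<dots> = V"
    by (simp add: V_def m_def power2_eq_square algebra_simps)
  finally have sq: "mean A (\<lambda>x. (h x)\<^sup>2) = V" .
  have "(\<Sum>S\<in>Pow A - {{}}. (1/4) ^ card S * (coef A F S)\<^sup>2)
      = (\<Sum>S\<in>Pow A - {{}}. (1/4) ^ card S * (coef A h S)\<^sup>2)"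
    by (intro sum.cong refl) (simp only: coef_h)
  also have "\<dots> \<le> (\<Sum>S\<in>Pow A. (1/4) ^ card S * (coef A h S)\<^sup>2)"
    using assms(2) by (intro sum_mono2) auto
  also have "\<dots> \<le> 2 * V * sqrt V"
    using noisy_energy_le[OF assms(2), of h] by (simp only: abs sq)
  finally show ?thesis .
qed

text \<open>The variance bound wins when \<open>V\<close> is at most
  \<open>(1/16) ^ (d + 1)\<close>, and the influence bound wins otherwise. The exponent
  \<open>4 * d + 2\<close> leaves \<open>(1/16) ^ (d + 1)\<close> after taking the root and paying
  \<open>16 ^ d\<close>.\<close>

lemma low_degree_weight_le_half_variance:
  fixes f :: "'a set \<Rightarrow> bool"
  defines "F \<equiv> \<lambda>x. of_bool (f x)"
  assumes "finite A"
  defines "V \<equiv> mean A F - (mean A F)\<^sup>2"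
  assumes small: "(\<Sum>i\<in>A. (infl A f i)\<^sup>2) \<le> (1/16) ^ (4 * d + 2)"
  shows "(\<Sum>S\<in>{S\<in>Pow A - {{}}. card S < d}. (coef A F S)\<^sup>2) \<le> V / 2"
proof -
  define W where "W = (\<Sum>S\<in>{S\<in>Pow A - {{}}. card S < d}. (coef A F S)\<^sup>2)"
  have V0: "0 \<le> V"
    using variance_eq_sum_coef[OF assms(2), of f] by (simp add: V_def F_def sum_nonneg)
  have weight: "r ^ d * W \<le> (\<Sum>S\<in>Pow A - {{}}. r ^ card S * (coef A F S)\<^sup>2)" if "0 \<le> r" "r \<le> 1" for r
  proof -
    have "r ^ d * W = (\<Sum>S\<in>{S\<in>Pow A - {{}}. card S < d}. r ^ d * (coef A F S)\<^sup>2)"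
      by (simp add: W_def sum_distrib_left)
    also have "\<dots> \<le> (\<Sum>S\<in>{S\<in>Pow A - {{}}. card S < d}. r ^ card S * (coef A F S)\<^sup>2)"
      using that by (intro sum_mono mult_right_mono power_decreasing) auto
    also have "\<dots> \<le> (\<Sum>S\<in>Pow A - {{}}. r ^ card S * (coef A F S)\<^sup>2)"
      using assms(2) that by (intro sum_mono2) auto
    finally show ?thesis .
  qed
  show ?thesis
  proof (cases "4 ^ (d + 1) * sqrt V \<le> 1")
    case True
    have "(1/4) ^ d * W \<le> 2 * V * sqrt V"
      using weight[of "1/4"] variance_energy_le[OF assms(2), of f] by (simp add: V_def F_def)
    then have "W \<le> 4 ^ d * (2 * V * sqrt V)"
      by (simp add: power_one_over field_simps)
    also have "\<dots> = (4 ^ (d + 1) * sqrt V) * (V / 2)"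
      by simp
    also have "\<dots> \<le> 1 * (V / 2)"
      using True V0 by (intro mult_right_mono) auto
    finally show ?thesis
      by (simp add: W_def)
  next
    case False
    then have "1 < (4 ^ (d + 1) * sqrt V)\<^sup>2"
      by (intro one_less_power) auto
    also have "\<dots> = (4 ^ (d + 1))\<^sup>2 * V"
      using V0 by (simp only: power_mult_distrib real_sqrt_pow2)
    also have "(4 ^ (d + 1))\<^sup>2 = (16 :: real) ^ (d + 1)"
      by (simp add: power2_eq_square flip: power_mult_distrib)
    finally have V: "1 \<le> 16 ^ (d + 1) * V"
      by simp
    have "(1/16) ^ d * W \<le> (\<Sum>S\<in>Pow A - {{}}. (1/16) ^ card S * (coef A F S)\<^sup>2)"
      by (rule weight) auto
    \<comment> \<open>Nonempty sets have \<open>card S \<ge> 1\<close>, so inserting this factor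
      only enlarges the sum.\<close>
    also have "\<dots> \<le> (\<Sum>S\<in>Pow A - {{}}. card S * ((1/16) ^ card S * (coef A F S)\<^sup>2))"
    proof (rule sum_mono)
      fix S assume "S \<in> Pow A - {{}}"
      then have "1 \<le> real (card S)"
        using assms(2) finite_subset[of S A] by (auto simp: Suc_le_eq card_gt_0_iff)
      from mult_right_mono[OF this]
      show "(1/16) ^ card S * (coef A F S)\<^sup>2 \<le> card S * ((1/16) ^ card S * (coef A F S)\<^sup>2)"
        by fastforce
    qed
    also have "\<dots> \<le> (\<Sum>S\<in>Pow A. card S * ((1/16) ^ card S * (coef A F S)\<^sup>2))"
      using assms(2) by (intro sum_mono2) auto
    also have "\<dots> \<le> sqrt (\<Sum>i\<in>A. (infl A f i)\<^sup>2) / 2"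
      unfolding F_def by (rule low_degree_energy_le[OF assms(2)])
    also have "sqrt (\<Sum>i\<in>A. (infl A f i)\<^sup>2) \<le> (1/16) ^ (2 * d + 1)"
    proof (rule real_le_lsqrt)
      have "((1/16::real) ^ (2 * d + 1))\<^sup>2 = (1/16) ^ (4 * d + 2)"
        unfolding power_mult[symmetric] by (rule arg_cong[of _ _ "(^) _"]) simp
      then show "(\<Sum>i\<in>A. (infl A f i)\<^sup>2) \<le> ((1/16) ^ (2 * d + 1))\<^sup>2"
        using small by simp
    qed simp
    finally have "(1/16) ^ d * W \<le> (1/16) ^ (2 * d + 1) / 2"
      by simp
    also have "\<dots> = (1/16) ^ d * ((1/16) ^ (d + 1) / 2)"
      by (simp add: power_add mult_2)
    finally have "W \<le> (1/16) ^ (d + 1) / 2"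
      by (simp add: mult_le_cancel_left)
    also have "\<dots> \<le> V / 2"
      using V by (simp add: power_one_over field_simps)
    finally show ?thesis
      by (simp add: W_def)
  qed
qed

subsection \<open>The inequality\<close>

text \<open>If \<open>L\<close> is bounded, the dimension-free bound \<open>2 * V\<close> suffices.
  Otherwise the levels from \<open>d\<close> on carry half the variance, and \<open>d\<close> is
  proportional to \<open>L\<close> up to constants.\<close>

lemma mean_sqrt_sens_ge_sqrt_log:
  fixes f :: "'a set \<Rightarrow> bool"
  assumes "finite A"
  defines "V \<equiv> mean A (\<lambda>x. of_bool (f x)) - (mean A (\<lambda>x. of_bool (f x)))\<^sup>2"
  defines "M \<equiv> \<Sum>i\<in>A. (infl A f i)\<^sup>2"
  shows "1/20 * V * sqrt (log 2 (1 + 1 / M)) \<le> mean A (\<lambda>x. sqrt (sens A f x))"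
proof -
  define F where "F x = (of_bool (f x) :: real)" for x
  define E where "E = mean A (\<lambda>x. sqrt (sens A f x))"
  define L where "L = log 2 (1 + 1 / M)"
  \<comment> \<open>The divisor 40 is generous: it must make \<open>M\<close> at most
    \<open>(1/16) ^ (4 * d + 2)\<close>, which is 2 to the power
    \<open>- (16 * d + 8)\<close>.\<close>
  define d where "d = nat \<lfloor>L / 40\<rfloor>"
  have M0: "0 \<le> M"
    by (simp add: M_def sum_nonneg)
  then have L0: "0 \<le> L"
    by (simp add: L_def zero_le_log_cancel_iff add_pos_nonneg)
  have V: "V = (\<Sum>S\<in>Pow A - {{}}. (coef A F S)\<^sup>2)"
    unfolding V_def F_def by (rule variance_eq_sum_coef[OF assms(1)])
  then have V0: "0 \<le> V"
    by (simp add: sum_nonneg)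
  have d_le: "real d \<le> L / 40" and d_gt: "L / 40 < real d + 1"
    using L0 of_int_floor_le[of "L / 40"] by (simp_all add: d_def del: of_int_floor_le)
  have "1/20 * V * sqrt L \<le> E"
  proof (cases "d = 0")
    case True
    then have "sqrt L \<le> 40"
      using d_gt by (intro real_le_lsqrt) auto
    then have "V * sqrt L \<le> V * 40"
      using V0 by (rule mult_left_mono)
    moreover have "2 * V \<le> E"
      unfolding V_def E_def by (rule mean_sqrt_sens_ge[OF assms(1)])
    ultimately show ?thesis
      by simp
  next
    case False
    then have d1: "1 \<le> d" by simp
    \<comment> \<open>If \<open>M = 0\<close>, division by zero gives \<open>1 / M = 0\<close>,
      hence \<open>L = 0\<close>, contradicting \<open>d \<ge> 1\<close>.\<close>
    have M1: "0 < M"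
      using M0 d1 d_le by (cases "M = 0") (auto simp: L_def)
    have "2 ^ (40 * d) = 2 powr (40 * real d)"
      by (simp flip: powr_realpow)
    also have "\<dots> \<le> 2 powr L"
      using d_le by simp
    also have "\<dots> = 1 + 1 / M"
      using M1 by (simp add: L_def add_pos_pos)
    finally have "2 ^ (40 * d) - 1 \<le> 1 / M"
      by simp
    moreover have "(16::real) ^ (4 * d + 2) \<le> 2 ^ (40 * d) - 1"
    proof -
      have "(16::real) ^ (4 * d + 2) = (2 ^ 4) ^ (4 * d + 2)"
        by simp
      also have "\<dots> = 2 ^ (4 * (4 * d + 2))"
        by (rule power_mult[symmetric])
      also have "\<dots> \<le> 2 ^ (40 * d - 1)"
        using d1 by (intro power_increasing) auto
      also have "\<dots> \<le> 2 ^ (40 * d) - 1"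
        using d1 one_le_power[of "2::real" "40 * d - 1"] by (cases "40 * d") auto
      finally show ?thesis .
    qed
    ultimately have "(16::real) ^ (4 * d + 2) \<le> 1 / M"
      by linarith
    then have "M \<le> (1/16) ^ (4 * d + 2)"
      using M1 by (simp add: power_one_over field_simps)
    then have "(\<Sum>S\<in>{S\<in>Pow A - {{}}. card S < d}. (coef A F S)\<^sup>2) \<le> V / 2"
      unfolding M_def V_def F_def by (rule low_degree_weight_le_half_variance[OF assms(1)])
    \<comment> \<open>Because \<open>d \<ge> 1\<close>, the empty set is not among the high levels,
      so low and high levels partition the nonempty sets.\<close>
    moreover have "V = (\<Sum>S\<in>{S\<in>Pow A - {{}}. card S < d}. (coef A F S)\<^sup>2)
        + (\<Sum>S\<in>{S\<in>Pow A. d \<le> card S}. (coef A F S)\<^sup>2)"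
      unfolding V using assms(1) d1
      by (subst sum.union_disjoint[symmetric]) (auto intro!: sum.cong)
    ultimately have "V / 2 \<le> (\<Sum>S\<in>{S\<in>Pow A. d \<le> card S}. (coef A F S)\<^sup>2)"
      by simp
    then have "sqrt d * (V / 2) \<le> sqrt d * (\<Sum>S\<in>{S\<in>Pow A. d \<le> card S}. (coef A F S)\<^sup>2)"
      by (rule mult_left_mono) simp
    also have "\<dots> \<le> E"
      unfolding F_def E_def by (rule high_degree_weight_le[OF assms(1) d1])
    finally have "sqrt d * (V / 2) \<le> E" .
    \<comment> \<open>Here \<open>L < 40 * (d + 1) \<le> 80 * d\<close>, rounded up to
      \<open>100 * d\<close> for a clean root. The 10 against the 1/2 of the variance gives the
      constant 1/20.\<close>
    moreover have "sqrt L \<le> 10 * sqrt d"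
    proof (rule real_le_lsqrt)
      show "L \<le> (10 * sqrt d)\<^sup>2"
        using d_gt d1 by (simp add: power_mult_distrib)
    qed simp
    then have "1/20 * V * sqrt L \<le> 1/20 * V * (10 * sqrt d)"
      using V0 by (intro mult_left_mono) auto
    ultimately show ?thesis
      by (simp add: mult.commute)
  qed
  then show ?thesis
    by (simp only: E_def L_def)
qed

section \<open>Transfer from subsets of \<open>{1..n}\<close> to the Boolean cube\<close>

definition bits :: "nat \<Rightarrow> nat set \<Rightarrow> nat \<Rightarrow> bool" where
  "bits n X = (\<lambda>i\<in>{1..n}. i \<in> X)"

lemma bij_betw_bits: "bij_betw (bits n) (Pow {1..n}) (cube n)"
proof (rule bij_betw_byWitness[where f'="\<lambda>x. {i\<in>{1..n}. x i}"])
  show "\<forall>x\<in>cube n. bits n {i\<in>{1..n}. x i} = x"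
  proof (intro ballI ext)
    fix x i assume "x \<in> cube n"
    \<comment> \<open>Outside \<open>{1..n}\<close> both sides are \<open>undefined\<close>, by the
      restricted abstraction in \<open>bits\<close> and the extensionality of
      \<open>x\<close>.\<close>
    then show "bits n {i\<in>{1..n}. x i} i = x i"
      using PiE_arb[of x "{1..n}" "\<lambda>_. UNIV" i] by (cases "i \<in> {1..n}") (simp_all add: bits_def cube_def)
  qed
qed (auto simp: bits_def cube_def)

lemma flip_bits: "i \<in> {1..n} \<Longrightarrow> flip (bits n X) i = bits n (sym_diff X {i})"
  by (auto simp: flip_def bits_def fun_eq_iff)

lemma expectation_unif: "measure_pmf.expectation (unif n) g = mean {1..n} (\<lambda>X. g (bits n X))"
proof -
  have "card (cube n) = 2 ^ n"
    using bij_betw_same_card[OF bij_betw_bits[of n]] by (simp add: card_Pow)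
  moreover have "(\<Sum>x\<in>cube n. g x) = (\<Sum>X\<in>Pow {1..n}. g (bits n X))"
    by (rule sum.reindex_bij_betw[symmetric, OF bij_betw_bits])
  ultimately show ?thesis
    using finite_cube cube_nonempty by (simp add: unif_def integral_pmf_of_set mean_eq)
qed

lemma sensitivity_bits: "sensitivity n f (bits n X) = sens {1..n} (\<lambda>X. f (bits n X)) X"
  unfolding sensitivity_def sens_def
  by (intro arg_cong[of _ _ card] Collect_cong conj_cong refl) (simp only: flip_bits)

lemma influence_eq_infl:
  assumes "i \<in> {1..n}"
  shows "influence n f i = infl {1..n} (\<lambda>X. f (bits n X)) i"
proof -
  have "influence n f i = measure_pmf.expectation (unif n) (indicator {x. f x \<noteq> f (flip x i)})"
    by (simp add: influence_def)
  also have "\<dots> = infl {1..n} (\<lambda>X. f (bits n X)) i"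
    unfolding expectation_unif infl_def using assms
    by (intro biased_mean_cong) (simp add: flip_bits)
  finally show ?thesis .
qed

theorem theorem1p3:
  shows "\<exists>c::real. c > 0 \<and>
    (\<forall>(n::nat) (f :: (nat \<Rightarrow> bool) \<Rightarrow> bool).
      n \<ge> 1 \<longrightarrow> \<not> f constant_on cube n \<longrightarrow>
        measure_pmf.expectation (unif n) (\<lambda>x. sqrt (real (sensitivity n f x)))
          \<ge> c * var n f * sqrt (log 2 (1 + 1 / (\<Sum>i=1..n. (influence n f i)\<^sup>2))))"
proof (intro exI[of _ "1/20"] conjI allI impI)
  fix n :: nat and f :: "(nat \<Rightarrow> bool) \<Rightarrow> bool"
  define g where "g X = f (bits n X)" for X
  have "var n f = mean {1..n} (\<lambda>X. of_bool (g X)) - (mean {1..n} (\<lambda>X. of_bool (g X)))\<^sup>2"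
    by (simp only: var_def expectation_unif g_def of_bool_power2)
  moreover have "(\<Sum>i=1..n. (influence n f i)\<^sup>2) = (\<Sum>i=1..n. (infl {1..n} g i)\<^sup>2)"
    by (intro sum.cong refl) (simp add: influence_eq_infl g_def[abs_def])
  moreover have "measure_pmf.expectation (unif n) (\<lambda>x. sqrt (sensitivity n f x))
      = mean {1..n} (\<lambda>X. sqrt (sens {1..n} g X))"
    by (simp add: expectation_unif sensitivity_bits g_def[abs_def])
  ultimately show "1/20 * var n f * sqrt (log 2 (1 + 1 / (\<Sum>i=1..n. (influence n f i)\<^sup>2)))
      \<le> measure_pmf.expectation (unif n) (\<lambda>x. sqrt (sensitivity n f x))"
    using mean_sqrt_sens_ge_sqrt_log[of "{1..n}" g] by simp
qed simp

end
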